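(* Let $I\subset\mathbb{R}$ be an interval, let $\gamma\in\mathbb{R}$ be a constant, and let $\alpha:I\to G_4$ be a special Frenet curve in the 4-dimensional Galilean space $G_4$, parametrized by Galilean arclength $t$, with Frenet frame $\{\mathbf t,\mathbf n,\mathbf b,\mathbf e\}$, whose first and second curvature functions $\kappa$ and $\tau$ are non-constant and satisfy $$\kappa(t)=\gamma\,\tau^{2}(t)\qquad\text{for all } t\in I.$$ If the curve $\alpha^*$ given by $$\alpha^*(t)=\alpha(t)+\gamma\,\mathbf n(t),\qquad t\in I,$$ is a special Frenet curve, then $\alpha^*$ is a generalized Mannheim mate curve of $\alpha$.
   Context: Galilean space: $G_4$ is $\mathbb{R}^4$ with Galilean scalar product of vectors $\langle a,b\rangle_G=a_1b_1$ if $a_1\neq 0$ or $b_1\neq 0$, and $\langle a,b\rangle_G=a_2b_2+a_3b_3+a_4b_4$ if $a_1=b_1=0$; the norm is $\|a\|=\sqrt{\langle a,a\rangle_G}$. Arclength: a curve parametrized by Galilean arclength has the form $\alpha(s)=(s,y(s),z(s),w(s))$ with $y,z,w$ smooth. Special Frenet curve: a smooth curve $\alpha$ parametrized by arclength, having a Frenet frame $\{\mathbf t,\mathbf n,\mathbf b,\mathbf e\}$ with $\mathbf t=\alpha'$ and smooth curvature functions $\kappa>0$ (first curvature), $\tau>0$ (second curvature) and $\sigma$ (third curvature) satisfying $$\mathbf t'=\kappa\,\mathbf n,\qquad \mathbf n'=\tau\,\mathbf b,\qquad \mathbf b'=-\tau\,\mathbf n+\sigma\,\mathbf e,\qquad \mathbf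 e'=-\sigma\,\mathbf b,$$ where $\mathbf t,\mathbf n,\mathbf b,\mathbf e$ are mutually orthogonal unit vectors with respect to $\langle\cdot,\cdot\rangle_G$ (in particular $\mathbf t$ has first coordinate $1$, while $\mathbf n,\mathbf b,\mathbf e$ have first coordinate $0$ and are orthonormal in the Euclidean sense in the last three coordinates). The lines through $\alpha(t)$ with directions $\mathbf n(t),\mathbf b(t),\mathbf e(t)$ are called the first, second and third normal lines of $\alpha$ at $\alpha(t)$. Generalized Mannheim mate curve: given special Frenet curves $\alpha:I\to G_4$ and $\alpha^*:I^*\to G_4$, each parametrized by arclength, with $\{\mathbf t^*,\mathbf n^*,\mathbf b^*,\mathbf e^*\}$ the frame of $\alpha^*$, the curve $\alpha^*$ is a generalized Mannheim mate curve of $\alpha$ (and $\alpha$ is a generalized Mannheim curve) if there is a bijection $\Psi:\alpha\to\alpha^*$, $\Psi(\alpha(t))=\alpha^*(f(t))$ with $f:I\to I^*$ smooth, such that at each point of $\alpha$ the first normal line of $\alpha$ is included in the plane generated by the second and third normal lines of $\alpha^*$ at the corresponding point under $\Psi$ (the plane through $\alpha^*(f(t))$ spanned by $\mathbf b^*(f(t))$ and $\mathbf e^*(f(t))$). *)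

theory Defs
  imports "HOL-Analysis.Analysis"
begin

section \<open>The Galilean space of dimension 4\<close>

definition galilean_inner :: "real ^ 4 \<Rightarrow> real ^ 4 \<Rightarrow> real" where
  "galilean_inner a b =
     (if a $ 1 \<noteq> 0 \<or> b $ 1 \<noteq> 0 then a $ 1 * b $ 1
      else a $ 2 * b $ 2 + a $ 3 * b $ 3 + a $ 4 * b $ 4)"

definition galilean_norm :: "real ^ 4 \<Rightarrow> real" where
  "galilean_norm a = sqrt (galilean_inner a a)"

definition galilean_orthonormal ::
  "real ^ 4 \<Rightarrow> real ^ 4 \<Rightarrow> real ^ 4 \<Rightarrow> real ^ 4 \<Rightarrow> bool" where
  "galilean_orthonormal t n b e \<longleftrightarrow>
     galilean_norm t = 1 \<and> galilean_norm n = 1 \<and> galilean_norm b = 1 \<and> galilean_norm e = 1 \<and>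
     galilean_inner t n = 0 \<and> galilean_inner t b = 0 \<and> galilean_inner t e = 0 \<and>
     galilean_inner n b = 0 \<and> galilean_inner n e = 0 \<and> galilean_inner b e = 0"

section \<open>Curves on an interval\<close>

text \<open>
  Intervals may be open, closed or half-open, bounded or not; derivatives are taken
  within the interval, hence are one-sided at an endpoint that belongs to it.
  In \<open>smooth_on\<close>, the function \<open>D k\<close> is the \<open>k\<close>-th derivative.
\<close>

definition nondegenerate_interval :: "real set \<Rightarrow> bool" where
  "nondegenerate_interval I \<longleftrightarrow> is_interval I \<and> interior I \<noteq> {}"

definition smooth_on :: "real set \<Rightarrow> (real \<Rightarrow> 'a::real_normed_vector) \<Rightarrow> bool" where
  "smooth_on I f \<longleftrightarrow>
     (\<exists>D :: nat \<Rightarrow> real \<Rightarrow> 'a.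
        (\<forall>s\<in>I. D 0 s = f s) \<and>
        (\<forall>k. \<forall>s\<in>I. (D k has_vector_derivative D (Suc k) s) (at s within I)))"

definition galilean_arclength :: "real set \<Rightarrow> (real \<Rightarrow> real ^ 4) \<Rightarrow> bool" where
  "galilean_arclength I \<alpha> \<longleftrightarrow> (\<forall>s\<in>I. \<alpha> s $ 1 = s)"

section \<open>Special Frenet curves\<close>

text \<open>
  Smoothness of the frame need not be required: it follows from the Frenet equations
  and the smoothness of the curvatures.
\<close>

definition frenet_apparatus ::
  "real set \<Rightarrow> (real \<Rightarrow> real ^ 4) \<Rightarrow>
   (real \<Rightarrow> real ^ 4) \<Rightarrow> (real \<Rightarrow> real ^ 4) \<Rightarrow> (real \<Rightarrow> real ^ 4) \<Rightarrow> (real \<Rightarrow> real ^ 4) \<Rightarrow>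
   (real \<Rightarrow> real) \<Rightarrow> (real \<Rightarrow> real) \<Rightarrow> (real \<Rightarrow> real) \<Rightarrow> bool" where
  "frenet_apparatus I \<alpha> t n b e \<kappa> \<tau> \<sigma> \<longleftrightarrow>
     nondegenerate_interval I \<and> smooth_on I \<alpha> \<and> galilean_arclength I \<alpha> \<and>
     smooth_on I \<kappa> \<and> smooth_on I \<tau> \<and> smooth_on I \<sigma> \<and>
     (\<forall>s\<in>I. \<kappa> s > 0 \<and> \<tau> s > 0) \<and>
     (\<forall>s\<in>I. galilean_orthonormal (t s) (n s) (b s) (e s)) \<and>
     (\<forall>s\<in>I. (\<alpha> has_vector_derivative t s) (at s within I)) \<and>
     (\<forall>s\<in>I. (t has_vector_derivative \<kappa> s *\<^sub>R n s) (at s within I)) \<and>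
     (\<forall>s\<in>I. (n has_vector_derivative \<tau> s *\<^sub>R b s) (at s within I)) \<and>
     (\<forall>s\<in>I. (b has_vector_derivative - \<tau> s *\<^sub>R n s + \<sigma> s *\<^sub>R e s) (at s within I)) \<and>
     (\<forall>s\<in>I. (e has_vector_derivative - \<sigma> s *\<^sub>R b s) (at s within I))"

definition special_frenet_curve :: "real set \<Rightarrow> (real \<Rightarrow> real ^ 4) \<Rightarrow> bool" where
  "special_frenet_curve I \<alpha> \<longleftrightarrow> (\<exists>t n b e \<kappa> \<tau> \<sigma>. frenet_apparatus I \<alpha> t n b e \<kappa> \<tau> \<sigma>)"

section \<open>Generalized Mannheim mate curves\<close>

definition line_through :: "real ^ 4 \<Rightarrow> real ^ 4 \<Rightarrow> (real ^ 4) set" where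
  "line_through p u = {p + x *\<^sub>R u | x. True}"

definition plane_through :: "real ^ 4 \<Rightarrow> real ^ 4 \<Rightarrow> real ^ 4 \<Rightarrow> (real ^ 4) set" where
  "plane_through p u v = {p + x *\<^sub>R u + y *\<^sub>R v | x y. True}"

text \<open>
  The frame of a special Frenet curve on its interval is unique up to the sign of the third
  normal (with the sign of \<open>\<sigma>\<close>), and that sign does not affect the plane below; so quantifying
  over all frames of the two curves amounts to speaking of the frame of each.
\<close>

definition generalized_mannheim_mate ::
  "real set \<Rightarrow> (real \<Rightarrow> real ^ 4) \<Rightarrow> real set \<Rightarrow> (real \<Rightarrow> real ^ 4) \<Rightarrow> bool" where
  "generalized_mannheim_mate I \<alpha> J \<beta> \<longleftrightarrow>
     special_frenet_curve I \<alpha> \<and> special_frenet_curve J \<beta> \<and>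
     (\<exists>\<Psi> f. bij_betw \<Psi> (\<alpha> ` I) (\<beta> ` J) \<and>
        smooth_on I f \<and> f ` I \<subseteq> J \<and> (\<forall>s\<in>I. \<Psi> (\<alpha> s) = \<beta> (f s)) \<and>
        (\<forall>t n b e \<kappa> \<tau> \<sigma> t' n' b' e' \<kappa>' \<tau>' \<sigma>'.
           frenet_apparatus I \<alpha> t n b e \<kappa> \<tau> \<sigma> \<longrightarrow>
           frenet_apparatus J \<beta> t' n' b' e' \<kappa>' \<tau>' \<sigma>' \<longrightarrow>
           (\<forall>s\<in>I. line_through (\<alpha> s) (n s)
                   \<subseteq> plane_through (\<beta> (f s)) (b' (f s)) (e' (f s)))))"

end

theory Submission
  imports Defs
begin

text \<open>
  Differentiating \<open>\<beta> = \<alpha> + \<gamma> n\<close> twice with the Frenet equations, the component of \<open>\<beta>''\<close> along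
  \<open>n\<close> is \<open>\<kappa> - \<gamma> \<tau>\<^sup>2 = 0\<close>. Hence the first normal of \<open>\<beta>\<close> is orthogonal to \<open>n\<close>, so \<open>n\<close> lies in the
  span of the second and third normals of \<open>\<beta>\<close>, and \<open>\<alpha>(s) + x n = \<beta>(s) + (x - \<gamma>) n\<close>.
\<close>

lemma nondegenerate_interval_islimpt:
  assumes "nondegenerate_interval I" "s \<in> I"
  shows "s islimpt I"
proof (rule connected_imp_perfect)
  show "connected I"
    using assms(1) by (simp add: nondegenerate_interval_def is_interval_connected)
  show "I \<noteq> {a}" for a
    using assms(1) by (auto simp: nondegenerate_interval_def)
qed (use assms(2) in simp)

text \<open>Every point of \<open>I\<close>, endpoints included, is a limit point of
  \<open>I\<close>. All comparisons of frame vectors below go through two expressions for one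
  derivative.\<close>

lemma nondegenerate_interval_derivative_unique:
  assumes "nondegenerate_interval I" "s \<in> I"
    and "(f has_vector_derivative u) (at s within I)"
    and "(f has_vector_derivative v) (at s within I)"
  shows "u = v"
  using assms nondegenerate_interval_islimpt trivial_limit_within
    vector_derivative_unique_within by metis

lemma smooth_on_has_vector_derivative:
  assumes "smooth_on I f" "s \<in> I"
  obtains v where "(f has_vector_derivative v) (at s within I)"
proof -
  obtain D where "\<forall>s\<in>I. D 0 s = f s"
    and "\<forall>k. \<forall>s\<in>I. (D k has_vector_derivative D (Suc k) s) (at s within I)"
    using assms(1) by (auto simp: smooth_on_def)
  then show ?thesis
    using that[of "D (Suc 0) s"] assms(2) has_vector_derivative_transform by metis
qed

lemma smooth_on_ident: "smooth_on I (\<lambda>x. x)"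
proof -
  define D :: "nat \<Rightarrow> real \<Rightarrow> real" where
    "D k = (case k of 0 \<Rightarrow> \<lambda>s. s | Suc 0 \<Rightarrow> \<lambda>s. 1 | _ \<Rightarrow> \<lambda>s. 0)" for k
  have "(D k has_vector_derivative D (Suc k) s) (at s within I)" for k s
    by (auto simp: D_def intro!: derivative_eq_intros split: nat.splits)
  then show ?thesis
    unfolding smooth_on_def by (intro exI[of _ D]) (simp add: D_def)
qed

text \<open>\<open>galilean_orthonormal\<close> treats its four vectors alike; it is the arclength
  parametrization that singles out \<open>t\<close> as the one with a nonzero first
  coordinate.\<close>

lemma frenet_apparatus_tangent_1:
  assumes "frenet_apparatus I \<alpha> t n b e \<kappa> \<tau> \<sigma>" "s \<in> I"
  shows "t s $ 1 = 1"
proof -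
  have "((\<lambda>s. \<alpha> s $ 1) has_vector_derivative t s $ 1) (at s within I)"
    using assms
    by (intro bounded_linear.has_vector_derivative[OF bounded_linear_vec_nth])
      (simp add: frenet_apparatus_def)
  moreover have "((\<lambda>s. \<alpha> s $ 1) has_vector_derivative 1) (at s within I)"
    using assms by (intro has_vector_derivative_transform[OF _ _ has_vector_derivative_id])
      (auto simp: frenet_apparatus_def galilean_arclength_def)
  ultimately show ?thesis
    using nondegenerate_interval_derivative_unique assms by (auto simp: frenet_apparatus_def)
qed

lemma galilean_inner_eq_inner:
  assumes "x $ 1 = 0" "y $ 1 = 0"
  shows "galilean_inner x y = x \<bullet> y"
  using assms by (simp add: galilean_inner_def inner_vec_def sum_4)

text \<open>Since \<open>t $ 1\<close> is nonzero, the product of \<open>t\<close> with each normal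
  is the product of first coordinates, so the normals have first coordinate 0. On such vectors the
  Galilean product is the Euclidean one.\<close>

lemma galilean_orthonormal_normals:
  assumes "galilean_orthonormal t n b e" "t $ 1 \<noteq> 0"
  shows "n $ 1 = 0" "b $ 1 = 0" "e $ 1 = 0"
    and "n \<bullet> n = 1" "b \<bullet> b = 1" "e \<bullet> e = 1"
    and "n \<bullet> b = 0" "n \<bullet> e = 0" "b \<bullet> e = 0"
proof -
  show "n $ 1 = 0" "b $ 1 = 0" "e $ 1 = 0"
    using assms by (auto simp: galilean_orthonormal_def galilean_inner_def)
  then show "n \<bullet> n = 1" "b \<bullet> b = 1" "e \<bullet> e = 1" "n \<bullet> b = 0" "n \<bullet> e = 0" "b \<bullet> e = 0"
    using assms(1)
    by (simp_all add: galilean_orthonormal_def galilean_norm_def galilean_inner_eq_inner)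
qed

text \<open>Together with the first axis, the three normals form a Euclidean orthonormal basis; the
  two conditions on \<open>x\<close> remove the components along the axis and along
  \<open>n\<close>.\<close>

lemma galilean_orthonormal_span:
  assumes on: "galilean_orthonormal t n b e" "t $ 1 \<noteq> 0"
    and x: "x $ 1 = 0" "x \<bullet> n = 0"
  obtains p q where "x = p *\<^sub>R b + q *\<^sub>R e"
proof -
  note nf = galilean_orthonormal_normals[OF on]
  \<comment> \<open>The axis replaces \<open>t\<close>, which need not be Euclidean-orthogonal to
    the normals.\<close>
  define a :: "real ^ 4" where "a = axis 1 1"
  have a: "y \<bullet> a = y $ 1" "a \<bullet> y = y $ 1" for y
    by (simp_all add: a_def inner_axis inner_axis')
  have "a \<bullet> a = 1"
    by (simp add: a_def)
  then have ne: "a \<noteq> n" "a \<noteq> b" "a \<noteq> e" "n \<noteq> b" "n \<noteq> e" "b \<noteq> e"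
    using nf a by force+
  have "independent {a, n, b, e}"
  proof (rule pairwise_orthogonal_independent)
    show "pairwise orthogonal {a, n, b, e}"
      using nf a inner_commute[of b n] inner_commute[of e n] inner_commute[of e b]
      by (simp add: pairwise_def orthogonal_def)
    show "0 \<notin> {a, n, b, e}"
      using nf \<open>a \<bullet> a = 1\<close> by auto
  qed
  moreover have "card {a, n, b, e} = 4"
    using ne by simp
  ultimately have "x \<in> span {a, n, b, e}"
    using card_ge_dim_independent[of "{a, n, b, e}" UNIV] by auto
  then obtain k l p q where "x - k *\<^sub>R a - l *\<^sub>R n - p *\<^sub>R b - q *\<^sub>R e = 0"
    by (auto simp: span_breakdown_eq)
  then have eq: "x = k *\<^sub>R a + l *\<^sub>R n + p *\<^sub>R b + q *\<^sub>R e"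
    by (simp add: algebra_simps)
  have "k = x \<bullet> a"
    using nf \<open>a \<bullet> a = 1\<close> by (subst eq) (simp add: inner_add_left a)
  moreover have "l = x \<bullet> n"
    using nf a inner_commute[of b n] inner_commute[of e n] by (subst eq) (simp add: inner_add_left)
  ultimately have "k = 0" "l = 0"
    using x by (simp_all only: a)
  then show ?thesis
    using that[of p q] eq by simp
qed

theorem theorem3p2:
  fixes I :: "real set" and \<gamma> :: real
    and \<alpha> \<beta> t n b e :: "real \<Rightarrow> real ^ 4"
    and \<kappa> \<tau> \<sigma> :: "real \<Rightarrow> real"
  assumes "is_interval I"
    and "frenet_apparatus I \<alpha> t n b e \<kappa> \<tau> \<sigma>"
    and "\<not> \<kappa> constant_on I"
    and "\<not> \<tau> constant_on I"
    and "\<forall>s\<in>I. \<kappa> s = \<gamma> * (\<tau> s)\<^sup>2"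
    and "\<beta> = (\<lambda>s. \<alpha> s + \<gamma> *\<^sub>R n s)"
    and "special_frenet_curve I \<beta>"
  shows "generalized_mannheim_mate I \<alpha> I \<beta>"
proof -
  note fa = assms(2)[unfolded frenet_apparatus_def]
  have nondeg: "nondegenerate_interval I"
    using fa by blast
  note unique = nondegenerate_interval_derivative_unique[OF nondeg]
  have \<alpha>1: "\<alpha> s $ 1 = s" if "s \<in> I" for s
    using fa that by (simp add: galilean_arclength_def)
  have \<beta>1: "\<beta> s $ 1 = s" if "s \<in> I" for s
    using assms(7) that
    by (auto simp: special_frenet_curve_def frenet_apparatus_def galilean_arclength_def)
  \<comment> \<open>On both curves the first coordinate of a point is its parameter, so each point
    determines its mate.\<close>
  have bij: "bij_betw (\<lambda>p. \<beta> (p $ 1)) (\<alpha> ` I) (\<beta> ` I)"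
    by (rule bij_betw_byWitness[of _ "\<lambda>p. \<alpha> (p $ 1)"]) (auto simp: \<alpha>1 \<beta>1)
  \<comment> \<open>The mate condition ranges over all frames of \<alpha>, so a second frame is
    compared with the given one.\<close>
  have mate: "line_through (\<alpha> s) (n2 s) \<subseteq> plane_through (\<beta> s) (b' s) (e' s)"
    if fr2: "frenet_apparatus I \<alpha> t2 n2 b2 e2 \<kappa>2 \<tau>2 \<sigma>2"
      and fr': "frenet_apparatus I \<beta> t' n' b' e' \<kappa>' \<tau>' \<sigma>'"
      and s: "s \<in> I"
    for t2 n2 b2 e2 \<kappa>2 \<tau>2 \<sigma>2 t' n' b' e' \<kappa>' \<tau>' \<sigma>' s
  proof -
    note f2 = fr2[unfolded frenet_apparatus_def]
    note f' = fr'[unfolded frenet_apparatus_def]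
    have on: "galilean_orthonormal (t s) (n s) (b s) (e s)" "t s $ 1 \<noteq> 0"
      using fa s frenet_apparatus_tangent_1[OF assms(2) s] by auto
    have on': "galilean_orthonormal (t' s) (n' s) (b' s) (e' s)" "t' s $ 1 \<noteq> 0"
      using f' s frenet_apparatus_tangent_1[OF fr' s] by auto
    note nf = galilean_orthonormal_normals[OF on]
    \<comment> \<open>Both tangents are derivatives of \<alpha>; differentiating once more shows
      that \<open>n2 s\<close> is parallel to \<open>n s\<close>.\<close>
    have "t2 r = t r" if "r \<in> I" for r
      using unique that fa f2 by blast
    then have "(t has_vector_derivative \<kappa>2 s *\<^sub>R n2 s) (at s within I)"
      using has_vector_derivative_transform[OF s] f2 s by metis
    then have n2: "\<kappa>2 s *\<^sub>R n2 s = \<kappa> s *\<^sub>R n s"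
      using unique s fa by blast
    have "(\<beta> has_vector_derivative t r + \<gamma> *\<^sub>R \<tau> r *\<^sub>R b r) (at r within I)" if "r \<in> I" for r
      unfolding assms(6) using fa that by (auto intro!: derivative_eq_intros)
    \<comment> \<open>The equation is established on all of \<open>I\<close> so that it can be
      differentiated at \<open>s\<close>.\<close>
    then have t': "t' r = t r + \<gamma> *\<^sub>R \<tau> r *\<^sub>R b r" if "r \<in> I" for r
      using unique that f' by blast
    obtain d where d: "(\<tau> has_vector_derivative d) (at s within I)"
      using smooth_on_has_vector_derivative fa s by blast
    have "((\<lambda>r. t r + \<gamma> *\<^sub>R \<tau> r *\<^sub>R b r) has_vector_derivative
        \<kappa> s *\<^sub>R n s + \<gamma> *\<^sub>R (\<tau> s *\<^sub>R (- \<tau> s *\<^sub>R n s + \<sigma> s *\<^sub>R e s) + d *\<^sub>R b s)) (at s within I)"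
      using fa s d
      by (intro has_vector_derivative_add has_vector_derivative_scaleR
          bounded_linear.has_vector_derivative[OF bounded_linear_scaleR_right])
        (auto simp: has_real_derivative_iff_has_vector_derivative)
    then have "(t' has_vector_derivative
        \<kappa> s *\<^sub>R n s + \<gamma> *\<^sub>R (\<tau> s *\<^sub>R (- \<tau> s *\<^sub>R n s + \<sigma> s *\<^sub>R e s) + d *\<^sub>R b s)) (at s within I)"
      by (rule has_vector_derivative_transform[OF s, rotated]) (rule t')
    then have "\<kappa>' s *\<^sub>R n' s =
        \<kappa> s *\<^sub>R n s + \<gamma> *\<^sub>R (\<tau> s *\<^sub>R (- \<tau> s *\<^sub>R n s + \<sigma> s *\<^sub>R e s) + d *\<^sub>R b s)"
      using unique s f' by blast
    \<comment> \<open>Pairing with \<open>n s\<close> removes the terms along \<open>b s\<close> and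
      \<open>e s\<close>, among them the one with the derivative \<open>d\<close> of \<tau>.\<close>
    then have "n s \<bullet> (\<kappa>' s *\<^sub>R n' s) = \<kappa> s - \<gamma> * (\<tau> s)\<^sup>2"
      using nf by (simp add: inner_add_right inner_diff_right power2_eq_square)
    \<comment> \<open>The right-hand side vanishes by the relation between \<kappa> and \<tau>, and
      \<open>\<kappa>' s\<close> is positive.\<close>
    then have "n s \<bullet> n' s = 0"
      using assms(5) f' s by auto
    then obtain p q where pq: "n s = p *\<^sub>R b' s + q *\<^sub>R e' s"
      using galilean_orthonormal_span[OF on'] nf(1) by blast
    have "\<kappa>2 s \<noteq> 0"
      using f2 s by force
    then have "n2 s = (\<kappa> s / \<kappa>2 s) *\<^sub>R n s"
      using n2 by (metis scaleR_scaleR divide_inverse_commute left_inverse scaleR_one)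
    then have "\<alpha> s + x *\<^sub>R n2 s = \<beta> s + (x * (\<kappa> s / \<kappa>2 s) - \<gamma>) *\<^sub>R n s" for x
      unfolding assms(6) by (simp add: algebra_simps)
    then have "\<alpha> s + x *\<^sub>R n2 s = \<beta> s + ((x * (\<kappa> s / \<kappa>2 s) - \<gamma>) * p) *\<^sub>R b' s
        + ((x * (\<kappa> s / \<kappa>2 s) - \<gamma>) * q) *\<^sub>R e' s" for x
      by (simp add: pq scaleR_add_right)
    then show ?thesis
      unfolding line_through_def plane_through_def by blast
  qed
  show ?thesis
    unfolding generalized_mannheim_mate_def
  proof (intro conjI exI)
    show "special_frenet_curve I \<alpha>"
      unfolding special_frenet_curve_def using assms(2) by blast
    \<comment> \<open>This goal fixes the parameter map as the identity; the next one then fixes the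
      bijection as \<open>\<lambda>p. \<beta> (p $ 1)\<close>.\<close>
    show "smooth_on I (\<lambda>s. s)"
      by (rule smooth_on_ident)
    show "\<forall>s\<in>I. \<beta> (\<alpha> s $ 1) = \<beta> s"
      by (simp add: \<alpha>1)
  qed (use assms(7) bij mate in auto)
qed

end
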